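(* For all integers $\ell,k,m \geq 1$, the following identity of formal power series in $t$ with coefficients in $\mathbb{Z}[x]$ holds: $$\begin{aligned} Q_{132}^{(\ell,k,0,m)}(t,x) ={}& \sum_{p=0}^{k+m-1} C_p t^p + t\sum_{i=0}^{k-2} C_i t^i \left( Q_{132}^{(\ell,k-1-i,0,m)}(t,x) - \sum_{r=0}^{k-i+m-2} C_rt^r \right) \\ &+ t \left( Q_{132}^{(\ell-1,k,0,0)}(t,x) - \sum_{a=0}^{k-2} C_a t^a \right) \left( Q_{132}^{(\ell,0,0,m)}(t,x) - \sum_{b=0}^{m-1} C_b t^b \right) \\ &+ t\sum_{j=0}^{m-1} C_j t^j \left( Q_{132}^{(\ell-1,k,0,m-j)}(t,x) - \sum_{s=0}^{k+m-j-2} C_st^s\right). \end{aligned}$$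
   Context: Let $\mathbb{N}=\{0,1,2,\ldots\}$. $S_n$ is the set of permutations $\sigma=\sigma_1\ldots\sigma_n$ of $\{1,\ldots,n\}$ in one-line notation, and $S_n(132)$ is the set of $\sigma\in S_n$ that avoid the pattern $132$, i.e. for which there are no indices $i<j<k$ with $\sigma_i<\sigma_k<\sigma_j$. For $a,b,c,d\in\mathbb{N}$, $\sigma_i$ matches the quadrant marked mesh pattern $\mathrm{MMP}(a,b,c,d)$ in $\sigma$ if all of the following hold: there are at least $a$ indices $j>i$ with $\sigma_j>\sigma_i$; at least $b$ indices $j<i$ with $\sigma_j>\sigma_i$; at least $c$ indices $j<i$ with $\sigma_j<\sigma_i$; and at least $d$ indices $j>i$ with $\sigma_j<\sigma_i$. Let $\mathrm{mmp}^{(a,b,c,d)}(\sigma)$ be the number of $i$ such that $\sigma_i$ matches $\mathrm{MMP}(a,b,c,d)$ in $\sigma$. For $n\ge 1$ put $Q_{n,132}^{(a,b,c,d)}(x)=\sum_{\sigma\in S_n(132)}x^{\mathrm{mmp}^{(a,b,c,d)}(\sigma)}$, and $Q_{132}^{(a,b,c,d)}(t,x)=1+\sum_{n\ge1}t^nQ_{n,132}^{(a,b,c,d)}(x)$. $C_n=\frac{1}{n+1}\binom{2n}{n}$ is the $n$-th Catalan number. Empty sums are $0$. *)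

theory Defs
  imports
    "HOL-Combinatorics.Permutations"
    "HOL-Computational_Algebra.Polynomial"
    "HOL-Computational_Algebra.Formal_Power_Series"
begin

(* A permutation of {1..n} in one-line notation is a function \<sigma> that permutes {1..n};
   its i-th letter is \<sigma> i. *)

definition avoids_132 :: "nat \<Rightarrow> (nat \<Rightarrow> nat) \<Rightarrow> bool" where
  "avoids_132 n \<sigma> \<longleftrightarrow>
     \<not> (\<exists>i\<in>{1..n}. \<exists>j\<in>{1..n}. \<exists>k\<in>{1..n}.
          i < j \<and> j < k \<and> \<sigma> i < \<sigma> k \<and> \<sigma> k < \<sigma> j)"

definition S132 :: "nat \<Rightarrow> (nat \<Rightarrow> nat) set" where
  "S132 n = {\<sigma>. \<sigma> permutes {1..n} \<and> avoids_132 n \<sigma>}"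

lemma finite_S132: "finite (S132 n)"
  by (rule finite_subset[OF _ finite_permutations[of "{1..n}"]]) (auto simp: S132_def)

definition matches_MMP ::
    "nat \<Rightarrow> nat \<Rightarrow> nat \<Rightarrow> nat \<Rightarrow> nat \<Rightarrow> (nat \<Rightarrow> nat) \<Rightarrow> nat \<Rightarrow> bool" where
  "matches_MMP a b c d n \<sigma> i \<longleftrightarrow>
     a \<le> card {j\<in>{1..n}. i < j \<and> \<sigma> i < \<sigma> j} \<and>
     b \<le> card {j\<in>{1..n}. j < i \<and> \<sigma> i < \<sigma> j} \<and>
     c \<le> card {j\<in>{1..n}. j < i \<and> \<sigma> j < \<sigma> i} \<and>
     d \<le> card {j\<in>{1..n}. i < j \<and> \<sigma> j < \<sigma> i}"

definition mmp :: "nat \<Rightarrow> nat \<Rightarrow> nat \<Rightarrow> nat \<Rightarrow> nat \<Rightarrow> (nat \<Rightarrow> nat) \<Rightarrow> nat" where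
  "mmp a b c d n \<sigma> = card {i\<in>{1..n}. matches_MMP a b c d n \<sigma> i}"

definition Qn132 :: "nat \<Rightarrow> nat \<Rightarrow> nat \<Rightarrow> nat \<Rightarrow> nat \<Rightarrow> int poly" where
  "Qn132 a b c d n = (\<Sum>\<sigma>\<in>S132 n. monom 1 (mmp a b c d n \<sigma>))"

(* The variable t is fps_X; x is the variable of the coefficient ring int poly. *)
definition Q132 :: "nat \<Rightarrow> nat \<Rightarrow> nat \<Rightarrow> nat \<Rightarrow> int poly fps" where
  "Q132 a b c d = Abs_fps (\<lambda>n. if n = 0 then 1 else Qn132 a b c d n)"

definition catalan :: "nat \<Rightarrow> nat" where
  "catalan n = (2 * n choose n) div (n + 1)"

(* The division in the definition is exact. *)
lemma catalan_exact: "(n + 1) * catalan n = (2 * n choose n)"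
proof -
  have "Suc n * (2 * n choose Suc n) = n * (2 * n choose n)"
    using binomial_absorb_comp[of "2 * n" n] binomial_absorption[of n "2 * n"]
    by (cases n) (auto simp: mult.commute)
  hence "Suc n dvd n * (2 * n choose n)"
    by (metis dvd_triv_left)
  moreover have "coprime (Suc n) n"
    by simp
  ultimately have "Suc n dvd (2 * n choose n)"
    by (simp add: coprime_dvd_mult_right_iff)
  thus ?thesis
    unfolding catalan_def Suc_eq_plus1 by (rule dvd_mult_div_cancel)
qed

abbreviation cat_term :: "nat \<Rightarrow> int poly fps" where
  "cat_term n \<equiv> of_nat (catalan n) * fps_X ^ n"

end

theory Submission
  imports Defs
begin

text \<open>
  A nonempty 132-avoiding permutation has the form \<open>\<alpha> N \<beta>\<close>, where \<open>N\<close> is its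
  maximum. A letter left of \<open>N\<close> that is smaller than a letter right of \<open>N\<close> would complete
  a 132 together with \<open>N\<close>, so every letter of \<open>\<alpha>\<close> exceeds every letter of \<open>\<beta>\<close>, and
  conversely two arbitrary 132-avoiding blocks of lengths \<open>r\<close> and \<open>s\<close> can be placed this way.
  Relative to its own block, a letter of \<open>\<alpha>\<close> gains one larger letter to its right (\<open>N\<close>)
  and \<open>s\<close> smaller letters to its right; a letter of \<open>\<beta>\<close> gains \<open>r + 1\<close> larger letters
  to its left; and \<open>N\<close> itself has nothing in its first quadrant. For \<open>a \<ge> 1\<close> this
  gives (theorem \<open>Qn132_Suc\<close>)
  \<open>Q\<^sub>n\<^sub>+\<^sub>1(a,b,c,d) = \<Sum>r\<le>n. Q\<^sub>r(a-1, b, c, d-(n-r)) Q\<^sub>n\<^sub>-\<^sub>r(a, b-(r+1), c, d)\<close>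
  with truncated subtraction.

  A match in \<open>MMP(a,b,c,d)\<close> needs \<open>a + b + c + d\<close> further letters, so
  \<open>Q\<^sub>n(a,b,c,d) = C\<^sub>n\<close> whenever \<open>n \<le> a + b + c + d\<close> (lemma \<open>Qn132_short\<close>). Hence all
  the subtractions of Catalan polynomials in the generating function identity merely cut off low
  coefficients (lemma \<open>Q132_tail_nth\<close>). Below degree \<open>k + m\<close> only the first sum of the
  identity survives. From degree \<open>k + m\<close> on, the recurrence splits into the
  three ranges \<open>r < k - 1\<close>, where the left factor is \<open>C\<^sub>r\<close>; \<open>n - r < m\<close>, where the right
  factor is \<open>C\<^sub>n\<^sub>-\<^sub>r\<close>; and the rest, where both truncated parameters are 0. These are the
  coefficients of the other three summands.
\<close>

section \<open>Catalan numbers\<close>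

lemma catalan_0 [simp]: "catalan 0 = 1"
  by (simp add: catalan_def)

lemma catalan_ratio: "(n + 2) * catalan (Suc n) = (4 * n + 2) * catalan n"
proof -
  have "Suc n * (2 * Suc n choose Suc n) = 2 * (Suc n * (Suc (2 * n) choose n))"
    using Suc_times_binomial_eq[of "Suc (2 * n)" n] by (simp add: algebra_simps)
  also have "Suc n * (Suc (2 * n) choose n) = Suc (2 * n) * (2 * n choose n)"
    using binomial_absorb_comp[of "Suc (2 * n)" n] by simp
  also have "2 * (Suc (2 * n) * (2 * n choose n)) = Suc n * ((4 * n + 2) * catalan n)"
    unfolding catalan_exact[of n, symmetric] by (simp add: algebra_simps)
  finally have "2 * Suc n choose Suc n = (4 * n + 2) * catalan n"
    by (subst (asm) mult_cancel1) simp
  then show ?thesis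
    using catalan_exact[of "Suc n"] by simp
qed

text \<open>
  With \<open>S n\<close> the convolution sum, the symmetry \<open>i \<leftrightarrow> n - i\<close> evaluates the weighted sum of
  \<open>i C\<^sub>i C\<^sub>n\<^sub>-\<^sub>i\<close> as \<open>n S n / 2\<close>. The ratio of consecutive Catalan numbers then expresses the
  weighted sum \<open>W\<close> of \<open>(i + 1) C\<^sub>i C\<^sub>n\<^sub>+\<^sub>1\<^sub>-\<^sub>i\<close> through \<open>S n\<close>, while symmetry expresses it
  through \<open>S (n + 1)\<close>; comparing the two gives the induction step.
\<close>

theorem catalan_convolution: "(\<Sum>i\<le>n. catalan i * catalan (n - i)) = catalan (Suc n)"
proof (induction n)
  case 0
  show ?case
    using catalan_ratio[of 0] by simp
next
  case (Suc n)
  define S where "S n = (\<Sum>i\<le>n. catalan i * catalan (n - i))" for n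
  have moment: "2 * (\<Sum>i\<le>n. i * (catalan i * catalan (n - i))) = n * S n" for n
  proof -
    have "(\<Sum>i\<le>n. i * (catalan i * catalan (n - i)))
        = (\<Sum>i\<le>n. (n - i) * (catalan i * catalan (n - i)))"
      unfolding atMost_atLeast0
      by (subst sum.atLeastAtMost_rev) (auto intro!: sum.cong simp: mult.commute)
    then have "2 * (\<Sum>i\<le>n. i * (catalan i * catalan (n - i)))
        = (\<Sum>i\<le>n. i * (catalan i * catalan (n - i)) + (n - i) * (catalan i * catalan (n - i)))"
      by (simp add: sum.distrib)
    also have "\<dots> = n * S n"
      unfolding S_def sum_distrib_left by (intro sum.cong) (auto simp flip: distrib_right)
    finally show ?thesis .
  qed
  define W where "W = (\<Sum>i\<le>Suc n. (i + 1) * (catalan i * catalan (Suc n - i)))"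
  have "W = catalan (Suc n) + (\<Sum>i\<le>n. ((i + 2) * catalan (Suc i)) * catalan (n - i))"
    unfolding W_def by (subst sum.atMost_Suc_shift) (simp add: algebra_simps)
  also have "(\<Sum>i\<le>n. ((i + 2) * catalan (Suc i)) * catalan (n - i))
      = 2 * (2 * (\<Sum>i\<le>n. i * (catalan i * catalan (n - i)))) + 2 * S n"
    unfolding catalan_ratio S_def sum_distrib_left sum.distrib[symmetric]
    by (intro sum.cong) (auto simp: algebra_simps)
  also have "\<dots> = (2 * n + 2) * S n"
    unfolding moment by (simp add: algebra_simps)
  finally have "W = catalan (Suc n) + (2 * n + 2) * S n" .
  moreover have "2 * W = (n + 3) * S (Suc n)"
    using moment[of "Suc n"] unfolding W_def add_mult_distrib sum.distrib
    by (simp add: S_def algebra_simps)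
  ultimately have "(n + 3) * S (Suc n) = (n + 3) * catalan (Suc (Suc n))"
    using Suc.IH catalan_ratio[of "Suc n"] by (simp add: S_def algebra_simps)
  then show ?case
    by (simp add: S_def)
qed

section \<open>Splitting a 132-avoiding permutation at its maximum\<close>

text \<open>
  The one-line notation is: the \<open>r\<close> letters of \<open>\<alpha>\<close> raised by \<open>s\<close>, the maximum, the
  \<open>s\<close> letters of \<open>\<beta>\<close>. The values outside the positions \<open>1, \<dots>, r + s + 1\<close> are those
  that a permutation of this range must take.
\<close>

definition glue :: "nat \<Rightarrow> nat \<Rightarrow> (nat \<Rightarrow> nat) \<Rightarrow> (nat \<Rightarrow> nat) \<Rightarrow> nat \<Rightarrow> nat" where
  "glue r s \<alpha> \<beta> p =
     (if p = 0 then 0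
      else if p \<le> r then \<alpha> p + s
      else if p = Suc r then Suc (r + s)
      else if p \<le> Suc (r + s) then \<beta> (p - Suc r)
      else p)"

lemma positions_split: "{1..Suc (r + s)} = {1..r} \<union> {Suc r} \<union> (+) (Suc r) ` {1..s}"
proof -
  have "(+) (Suc r) ` {1..s} = {Suc (Suc r)..Suc (r + s)}"
    by (simp only: image_add_atLeastAtMost) (simp add: add.commute)
  then show ?thesis
    by (auto simp del: image_add_atLeastAtMost)
qed

lemma position_cases [consumes 1, case_names Left Max Right]:
  assumes "p \<in> {1..Suc (r + s)}"
  obtains "p \<in> {1..r}" | "p = Suc r" | q where "q \<in> {1..s}" "p = Suc r + q"
  using assms unfolding positions_split by blast

lemma card_positions_split:
  "card {p \<in> {1..Suc (r + s)}. P p}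
     = card {p \<in> {1..r}. P p} + (if P (Suc r) then 1 else 0) + card {q \<in> {1..s}. P (Suc r + q)}"
proof -
  let ?L = "{p \<in> {1..r}. P p}" and ?M = "if P (Suc r) then {Suc r} else {}"
    and ?R = "(+) (Suc r) ` {q \<in> {1..s}. P (Suc r + q)}"
  have "{p \<in> {1..Suc (r + s)}. P p} = (?L \<union> ?M) \<union> ?R"
    unfolding positions_split by (auto simp del: atLeastAtMost_iff)
  moreover have "card ((?L \<union> ?M) \<union> ?R) = card (?L \<union> ?M) + card ?R"
    by (rule card_Un_disjoint) (auto split: if_splits)
  moreover have "card (?L \<union> ?M) = card ?L + card ?M"
    by (rule card_Un_disjoint) (auto split: if_splits)
  moreover have "card ?R = card {q \<in> {1..s}. P (Suc r + q)}"
    by (rule card_image) simp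
  moreover have "card ?M = (if P (Suc r) then 1 else 0)"
    by simp
  ultimately show ?thesis
    by (simp only:)
qed

lemma endo_inj_permutes:
  assumes "finite A" "\<And>x. x \<in> A \<Longrightarrow> f x \<in> A" "inj_on f A" "\<And>x. x \<notin> A \<Longrightarrow> f x = x"
  shows "f permutes A"
  using assms by (intro bij_imp_permutes) (auto simp: bij_betw_def endo_inj_surj image_subset_iff)

lemma S132_range: "\<alpha> \<in> S132 n \<Longrightarrow> p \<in> {1..n} \<Longrightarrow> \<alpha> p \<in> {1..n}"
  by (simp add: S132_def permutes_in_image del: atLeastAtMost_iff)

lemma S132_inj: "\<alpha> \<in> S132 n \<Longrightarrow> \<alpha> p = \<alpha> q \<longleftrightarrow> p = q"
  by (auto simp: S132_def dest: permutes_inj injD)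

lemma S132_fixes: "\<alpha> \<in> S132 n \<Longrightarrow> p \<notin> {1..n} \<Longrightarrow> \<alpha> p = p"
  by (auto simp: S132_def dest: permutes_not_in)

lemma S132_no_pattern:
  assumes "\<alpha> \<in> S132 n" "1 \<le> i" "i < j" "j < k" "k \<le> n"
  shows "\<not> (\<alpha> i < \<alpha> k \<and> \<alpha> k < \<alpha> j)"
proof -
  have "i \<in> {1..n}" "j \<in> {1..n}" "k \<in> {1..n}"
    using assms by auto
  with assms show ?thesis
    unfolding S132_def avoids_132_def by blast
qed

lemma glue_left: "p \<in> {1..r} \<Longrightarrow> glue r s \<alpha> \<beta> p = \<alpha> p + s"
  and glue_max: "glue r s \<alpha> \<beta> (Suc r) = Suc (r + s)"
  and glue_right: "q \<in> {1..s} \<Longrightarrow> glue r s \<alpha> \<beta> (Suc r + q) = \<beta> q"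
  by (auto simp: glue_def)

lemma glue_left_range:
  "\<alpha> \<in> S132 r \<Longrightarrow> p \<in> {1..r} \<Longrightarrow> s < glue r s \<alpha> \<beta> p \<and> glue r s \<alpha> \<beta> p \<le> r + s"
  using S132_range[of \<alpha> r p] by (simp add: glue_left)

lemma glue_right_range:
  "\<beta> \<in> S132 s \<Longrightarrow> q \<in> {1..s} \<Longrightarrow>
     0 < glue r s \<alpha> \<beta> (Suc r + q) \<and> glue r s \<alpha> \<beta> (Suc r + q) \<le> s"
  using S132_range[of \<beta> s q] by (simp add: glue_right del: add_Suc)

lemma glue_in_S132:
  assumes "\<alpha> \<in> S132 r" and "\<beta> \<in> S132 s"
  shows "glue r s \<alpha> \<beta> \<in> S132 (Suc (r + s))"
proof -
  let ?g = "glue r s \<alpha> \<beta>" and ?N = "{1..Suc (r + s)}"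
  note lr = glue_left_range[OF assms(1), of _ s \<beta>] and rr = glue_right_range[OF assms(2), of _ r \<alpha>]
  have "?g permutes ?N"
  proof (rule endo_inj_permutes)
    show "?g p \<in> ?N" if "p \<in> ?N" for p
      using that
    proof (cases rule: position_cases)
      case Left
      from lr[OF this] show ?thesis by auto
    next
      case Max
      then show ?thesis by (simp add: glue_max)
    next
      case (Right q)
      with rr[of q] show ?thesis by auto
    qed
    show "inj_on ?g ?N"
    proof (rule linorder_inj_onI')
      fix p q assume *: "p \<in> ?N" "q \<in> ?N" "p < q"
      from *(2) show "?g p \<noteq> ?g q"
      proof (cases rule: position_cases)
        case Left
        with * S132_inj[OF assms(1)] show ?thesis by (simp add: glue_left)
      next
        case Max
        with * lr[of p] show ?thesis by (simp add: glue_max)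
      next
        case q: (Right q')
        from *(1) show ?thesis
        proof (cases rule: position_cases)
          case Left
          from lr[OF this] rr[OF q(1)] q show ?thesis by simp
        next
          case Max
          with rr[OF q(1)] q show ?thesis by (simp add: glue_max)
        next
          case (Right p')
          with *(3) S132_inj[OF assms(2)] q show ?thesis 
            by (simp add: glue_right del: add_Suc)
        qed
      qed
    qed
    show "?g p = p" if "p \<notin> ?N" for p
      using that by (auto simp: glue_def)
  qed simp
  moreover have "avoids_132 (Suc (r + s)) ?g"
    unfolding avoids_132_def
  proof safe
    fix i j k assume *: "i \<in> ?N" "j \<in> ?N" "k \<in> ?N" "i < j" "j < k" "?g i < ?g k" "?g k < ?g j"
    from *(3) show False
    proof (cases rule: position_cases)
      case Left
      then have "i \<in> {1..r}" "j \<in> {1..r}" "k \<in> {1..r}"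
        using * by auto
      with * S132_no_pattern[OF assms(1), of i j k] show False
        by (simp add: glue_left)
    next
      case Max
      then have "j \<in> {1..r}"
        using * by auto
      with Max *(7) lr[of j] show False
        by (simp add: glue_max)
    next
      case k: (Right k')
      from *(1) show False
      proof (cases rule: position_cases)
        case Left
        with *(6) lr[of i] rr[OF k(1)] k show False by simp
      next
        case Max
        with *(6) rr[OF k(1)] k show False by (simp add: glue_max)
      next
        case i: (Right i')
        define j' where "j' = j - Suc r"
        have j: "j = Suc r + j'" "j' \<in> {1..s}" "i' < j'" "j' < k'"
          using * i k by (auto simp: j'_def)
        show False
          using S132_no_pattern[OF assms(2), of i' j' k'] *(6,7) i k j
          by (simp add: glue_right del: add_Suc)
      qed
    qed
  qed
  ultimately show ?thesis
    by (simp add: S132_def)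
qed

text \<open>The position of the maximum determines the block lengths, and these determine the blocks.\<close>

lemma glue_cancel:
  assumes "\<alpha> \<in> S132 r" "\<beta> \<in> S132 s" "\<alpha>' \<in> S132 r'" "\<beta>' \<in> S132 s'" "r + s = r' + s'"
    and eq: "glue r s \<alpha> \<beta> = glue r' s' \<alpha>' \<beta>'"
  shows "r = r' \<and> \<alpha> = \<alpha>' \<and> \<beta> = \<beta>'"
proof -
  have "glue r s \<alpha> \<beta> (Suc r') = glue r s \<alpha> \<beta> (Suc r)"
    using assms(5) glue_max[of r s \<alpha> \<beta>] glue_max[of r' s' \<alpha>' \<beta>'] unfolding eq by simp
  then have [simp]: "r' = r"
    using S132_inj[OF glue_in_S132[OF assms(1,2)]] by simp
  then have [simp]: "s' = s"
    using assms(5) by simp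
  have "\<alpha> p = \<alpha>' p" for p
  proof (cases "p \<in> {1..r}")
    case True
    with fun_cong[OF eq, of p] show ?thesis by (simp add: glue_left)
  next
    case False
    with assms S132_fixes show ?thesis by (metis \<open>r' = r\<close>)
  qed
  moreover have "\<beta> q = \<beta>' q" for q
  proof (cases "q \<in> {1..s}")
    case True
    with fun_cong[OF eq, of "Suc r + q"] show ?thesis by (simp add: glue_right del: add_Suc)
  next
    case False
    with assms S132_fixes show ?thesis by (metis \<open>s' = s\<close>)
  qed
  ultimately show ?thesis
    by auto
qed

text \<open>
  The set \<open>V\<close> of letters right of the maximum is closed under smaller letters: a smaller
  letter left of the maximum would start a 132. So every element of \<open>V\<close> is bounded by the
  size \<open>s\<close> of \<open>V\<close>, which forces \<open>V = {1..s}\<close> and leaves exactly the larger letters for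
  the positions left of the maximum.
\<close>

lemma S132_splits_at_max:
  assumes "\<sigma> \<in> S132 (Suc n)"
  obtains r s \<alpha> \<beta> where "n = r + s" "\<alpha> \<in> S132 r" "\<beta> \<in> S132 s" "\<sigma> = glue r s \<alpha> \<beta>"
proof -
  have perm: "\<sigma> permutes {1..Suc n}"
    using assms by (simp add: S132_def)
  then have "Suc n \<in> \<sigma> ` {1..Suc n}"
    by (simp add: permutes_image)
  then obtain p where p: "p \<in> {1..Suc n}" "\<sigma> p = Suc n"
    by force
  define r where "r = p - 1"
  define s where "s = n - r"
  have n: "n = r + s" and max: "\<sigma> (Suc r) = Suc (r + s)"
    using p by (auto simp: r_def s_def)
  note \<sigma> = assms[unfolded n]
  define V where "V = (\<lambda>q. \<sigma> (Suc r + q)) ` {1..s}"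
  have card_V: "card V = s"
    unfolding V_def by (subst card_image) (auto intro!: inj_onI simp: S132_inj[OF \<sigma>])
  have small: "\<sigma> (Suc r + q) \<le> s" if q: "q \<in> {1..s}" for q
  proof -
    have "{1..\<sigma> (Suc r + q)} \<subseteq> V"
    proof
      fix v assume v: "v \<in> {1..\<sigma> (Suc r + q)}"
      have q_range: "\<sigma> (Suc r + q) \<in> {1..Suc (r + s)}"
        using S132_range[OF \<sigma>, of "Suc r + q"] q by simp
      then have "v \<in> \<sigma> ` {1..Suc (r + s)}"
        using v perm[unfolded n] by (simp add: permutes_image)
      then obtain u where u: "u \<in> {1..Suc (r + s)}" "\<sigma> u = v"
        by blast
      from u(1) show "v \<in> V"
      proof (cases rule: position_cases)
        case Left
        have "\<sigma> (Suc r + q) < Suc (r + s)"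
          using q_range S132_inj[OF \<sigma>, of "Suc r + q" "Suc r"] q max by auto
        moreover have "v \<noteq> \<sigma> (Suc r + q)"
          using u Left S132_inj[OF \<sigma>, of u "Suc r + q"] by auto
        ultimately show ?thesis
          using S132_no_pattern[OF \<sigma>, of u "Suc r" "Suc r + q"] Left u v q max by auto
      next
        case Max
        with u max v q_range S132_inj[OF \<sigma>, of "Suc r + q" "Suc r"] q show ?thesis by auto
      next
        case (Right q')
        with u show ?thesis by (auto simp: V_def)
      qed
    qed
    then have "card {1..\<sigma> (Suc r + q)} \<le> card V"
      by (intro card_mono) (auto simp: V_def)
    with card_V show ?thesis by simp
  qed
  have "V \<subseteq> {1..s}"
    using small S132_range[OF \<sigma>, of "Suc r + _"] by (fastforce simp: V_def)
  then have V: "V = {1..s}"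
    using card_V by (intro card_subset_eq) auto
  have large: "s < \<sigma> p \<and> \<sigma> p \<le> r + s" if "p \<in> {1..r}" for p
  proof -
    have "\<sigma> p \<notin> V"
      using that S132_inj[OF \<sigma>] by (auto simp: V_def)
    moreover have "\<sigma> p \<in> {1..Suc (r + s)}"
      using S132_range[OF \<sigma>, of p] that by simp
    moreover have "\<sigma> p \<noteq> Suc (r + s)"
      using S132_inj[OF \<sigma>, of p "Suc r"] max that by auto
    ultimately show ?thesis
      unfolding V by auto
  qed
  define \<alpha> where "\<alpha> p = (if p \<in> {1..r} then \<sigma> p - s else p)" for p
  define \<beta> where "\<beta> q = (if q \<in> {1..s} then \<sigma> (Suc r + q) else q)" for q
  have "\<alpha> permutes {1..r}"
  proof (rule endo_inj_permutes)
    show "inj_on \<alpha> {1..r}"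
    proof (rule inj_onI)
      fix p q assume "p \<in> {1..r}" "q \<in> {1..r}" "\<alpha> p = \<alpha> q"
      with large[of p] large[of q] have "\<sigma> p = \<sigma> q"
        by (simp add: \<alpha>_def eq_diff_iff less_imp_le)
      then show "p = q"
        by (simp add: S132_inj[OF \<sigma>])
    qed
    show "\<alpha> p \<in> {1..r}" if "p \<in> {1..r}" for p
      using large[OF that] that by (auto simp: \<alpha>_def)
  qed (auto simp: \<alpha>_def)
  moreover have "avoids_132 r \<alpha>"
    unfolding avoids_132_def
  proof safe
    fix i j k assume *: "i \<in> {1..r}" "j \<in> {1..r}" "k \<in> {1..r}" "i < j" "j < k" "\<alpha> i < \<alpha> k" "\<alpha> k < \<alpha> j"
    with S132_no_pattern[OF \<sigma>, of i j k] large[of i] large[of j] large[of k] show False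
      by (auto simp: \<alpha>_def)
  qed
  ultimately have "\<alpha> \<in> S132 r"
    by (simp add: S132_def)
  have "\<beta> permutes {1..s}"
  proof (rule endo_inj_permutes)
    show "inj_on \<beta> {1..s}"
      using S132_inj[OF \<sigma>] by (auto intro!: inj_onI simp: \<beta>_def)
    show "\<beta> q \<in> {1..s}" if "q \<in> {1..s}" for q
      using that V by (auto simp: \<beta>_def V_def simp del: atLeastAtMost_iff)
  qed (auto simp: \<beta>_def)
  moreover have "avoids_132 s \<beta>"
    unfolding avoids_132_def
  proof safe
    fix i j k assume *: "i \<in> {1..s}" "j \<in> {1..s}" "k \<in> {1..s}" "i < j" "j < k" "\<beta> i < \<beta> k" "\<beta> k < \<beta> j"
    with S132_no_pattern[OF \<sigma>, of "Suc r + i" "Suc r + j" "Suc r + k"] show False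
      by (auto simp: \<beta>_def)
  qed
  ultimately have "\<beta> \<in> S132 s"
    by (simp add: S132_def)
  have "\<sigma> p = glue r s \<alpha> \<beta> p" for p
  proof (cases "p \<in> {1..Suc (r + s)}")
    case True
    then show ?thesis
    proof (cases rule: position_cases)
      case Left
      with large[OF this] show ?thesis by (simp add: glue_left \<alpha>_def)
    next
      case Max
      with max show ?thesis by (simp add: glue_max)
    next
      case (Right q)
      then show ?thesis by (simp add: glue_right \<beta>_def del: add_Suc)
    qed
  next
    case False
    then have "\<sigma> p = p"
      by (rule S132_fixes[OF \<sigma>])
    with False show ?thesis
      by (auto simp: glue_def)
  qed
  then have "\<sigma> = glue r s \<alpha> \<beta>"
    by blast
  with \<open>\<alpha> \<in> S132 r\<close> \<open>\<beta> \<in> S132 s\<close> n show ?thesis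
    using that by blast
qed

lemma sum_S132_Suc:
  "(\<Sum>\<sigma>\<in>S132 (Suc n). f \<sigma>)
     = (\<Sum>r\<le>n. \<Sum>\<alpha>\<in>S132 r. \<Sum>\<beta>\<in>S132 (n - r). f (glue r (n - r) \<alpha> \<beta>))"
proof -
  let ?D = "SIGMA r:{..n}. S132 r \<times> S132 (n - r)"
  have "bij_betw (\<lambda>(r, \<alpha>, \<beta>). glue r (n - r) \<alpha> \<beta>) ?D (S132 (Suc n))"
  proof (rule bij_betw_imageI)
    show "inj_on (\<lambda>(r, \<alpha>, \<beta>). glue r (n - r) \<alpha> \<beta>) ?D"
      by (rule inj_onI) (auto dest!: glue_cancel[rotated 5])
    show "(\<lambda>(r, \<alpha>, \<beta>). glue r (n - r) \<alpha> \<beta>) ` ?D = S132 (Suc n)"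
    proof safe
      fix r \<alpha> \<beta> assume "r \<le> n" "\<alpha> \<in> S132 r" "\<beta> \<in> S132 (n - r)"
      then show "glue r (n - r) \<alpha> \<beta> \<in> S132 (Suc n)"
        using glue_in_S132[of \<alpha> r \<beta> "n - r"] by simp
    next
      fix \<sigma> assume "\<sigma> \<in> S132 (Suc n)"
      then obtain r s \<alpha> \<beta> where "n = r + s" "\<alpha> \<in> S132 r" "\<beta> \<in> S132 s" "\<sigma> = glue r s \<alpha> \<beta>"
        by (rule S132_splits_at_max)
      then show "\<sigma> \<in> (\<lambda>(r, \<alpha>, \<beta>). glue r (n - r) \<alpha> \<beta>) ` ?D"
        by (intro image_eqI[of _ _ "(r, \<alpha>, \<beta>)"]) auto
    qed
  qed
  then have "(\<Sum>\<sigma>\<in>S132 (Suc n). f \<sigma>) = (\<Sum>(r, \<alpha>, \<beta>)\<in>?D. f (glue r (n - r) \<alpha> \<beta>))"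
    by (subst sum.reindex_bij_betw[symmetric]) (auto simp: case_prod_unfold)
  also have "\<dots> = (\<Sum>r\<le>n. \<Sum>\<alpha>\<in>S132 r. \<Sum>\<beta>\<in>S132 (n - r). f (glue r (n - r) \<alpha> \<beta>))"
    by (simp add: sum.cartesian_product sum.Sigma finite_S132)
  finally show ?thesis .
qed

lemma S132_0: "S132 0 = {id}"
  by (auto simp: S132_def avoids_132_def)

text \<open>Splitting at the maximum gives the recurrence of the Catalan numbers.\<close>

theorem card_S132: "card (S132 n) = catalan n"
proof (induction n rule: less_induct)
  case (less n)
  show ?case
  proof (cases n)
    case 0
    then show ?thesis by (simp add: S132_0)
  next
    case (Suc n')
    have "card (S132 n) = (\<Sum>r\<le>n'. card (S132 r) * card (S132 (n' - r)))"
      using sum_S132_Suc[of "\<lambda>_. 1::nat" n'] by (simp add: Suc)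
    also have "\<dots> = (\<Sum>r\<le>n'. catalan r * catalan (n' - r))"
      by (intro sum.cong) (auto simp: less.IH Suc)
    finally show ?thesis
      by (simp add: Suc catalan_convolution)
  qed
qed

section \<open>Quadrant statistics of a glued permutation\<close>

text \<open>
  In the left block the maximum supplies one point of the first quadrant and the whole right
  block lies in the fourth quadrant, so these two requirements drop by \<open>1\<close> and \<open>s\<close>.
\<close>

lemma matches_glue_left:
  assumes "\<alpha> \<in> S132 r" "\<beta> \<in> S132 s" "1 \<le> a" "p \<in> {1..r}"
  shows "matches_MMP a b c d (Suc (r + s)) (glue r s \<alpha> \<beta>) p
     \<longleftrightarrow> matches_MMP (a - 1) b c (d - s) r \<alpha> p"
proof -
  let ?g = "glue r s \<alpha> \<beta>"
  note lr = glue_left_range[OF assms(1), of _ s \<beta>] and rr = glue_right_range[OF assms(2), of _ r \<alpha>]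
  have iff: "?g p < ?g j \<longleftrightarrow> \<alpha> p < \<alpha> j" "?g j < ?g p \<longleftrightarrow> \<alpha> j < \<alpha> p" if "j \<in> {1..r}" for j
    using that assms(4) by (simp_all add: glue_left)
  have max: "?g p < ?g (Suc r)" "\<not> ?g (Suc r) < ?g p" "p < Suc r"
    using lr[OF assms(4)] assms(4) by (auto simp: glue_max)
  have right: "\<not> ?g p < ?g (Suc r + q)" "?g (Suc r + q) < ?g p" "p < Suc r + q" if "q \<in> {1..s}" for q
    using lr[OF assms(4)] rr[OF that] assms(4) by auto
  have "card {j \<in> {1..Suc (r + s)}. p < j \<and> ?g p < ?g j} = card {j \<in> {1..r}. p < j \<and> \<alpha> p < \<alpha> j} + 1"
    unfolding card_positions_split using iff max right
    by (simp cong: conj_cong del: atLeastAtMost_iff add_Suc)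
  moreover have "card {j \<in> {1..Suc (r + s)}. j < p \<and> ?g p < ?g j} = card {j \<in> {1..r}. j < p \<and> \<alpha> p < \<alpha> j}"
    unfolding card_positions_split using iff max right
    by (simp cong: conj_cong del: atLeastAtMost_iff add_Suc)
  moreover have "card {j \<in> {1..Suc (r + s)}. j < p \<and> ?g j < ?g p} = card {j \<in> {1..r}. j < p \<and> \<alpha> j < \<alpha> p}"
    unfolding card_positions_split using iff max right less_asym[of p]
    by (simp cong: conj_cong del: atLeastAtMost_iff add_Suc)
  moreover have "card {j \<in> {1..Suc (r + s)}. p < j \<and> ?g j < ?g p} = card {j \<in> {1..r}. p < j \<and> \<alpha> j < \<alpha> p} + s"
    unfolding card_positions_split using iff max right
    by (simp cong: conj_cong del: atLeastAtMost_iff add_Suc)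
  ultimately show ?thesis
    using assms(3) unfolding matches_MMP_def by auto
qed

lemma not_matches_glue_max:
  assumes "\<alpha> \<in> S132 r" "\<beta> \<in> S132 s" "1 \<le> a"
  shows "\<not> matches_MMP a b c d (Suc (r + s)) (glue r s \<alpha> \<beta>) (Suc r)"
proof -
  have "glue r s \<alpha> \<beta> j \<le> Suc (r + s)" if "j \<in> {1..Suc (r + s)}" for j
    using S132_range[OF glue_in_S132[OF assms(1,2)] that] by simp
  then have "card {j \<in> {1..Suc (r + s)}. Suc r < j \<and> glue r s \<alpha> \<beta> (Suc r) < glue r s \<alpha> \<beta> j} = 0"
    by (auto simp: glue_max not_less card_eq_0_iff)
  with assms(3) show ?thesis
    unfolding matches_MMP_def by linarith
qed

text \<open>
  For the right block, the left block and the maximum lie in the second quadrant, which lowers that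
  requirement by \<open>r + 1\<close>.
\<close>

lemma matches_glue_right:
  assumes "\<alpha> \<in> S132 r" "\<beta> \<in> S132 s" "q \<in> {1..s}"
  shows "matches_MMP a b c d (Suc (r + s)) (glue r s \<alpha> \<beta>) (Suc r + q)
     \<longleftrightarrow> matches_MMP a (b - Suc r) c d s \<beta> q"
proof -
  let ?g = "glue r s \<alpha> \<beta>" and ?p = "Suc r + q"
  note lr = glue_left_range[OF assms(1), of _ s \<beta>] and rr = glue_right_range[OF assms(2), of _ r \<alpha>]
  have left: "?g ?p < ?g j" "\<not> ?g j < ?g ?p" "j < ?p" "\<not> ?p < j" if "j \<in> {1..r}" for j
    using lr[OF that] rr[OF assms(3)] that by auto
  have max: "?g ?p < ?g (Suc r)" "\<not> ?g (Suc r) < ?g ?p" "Suc r < ?p"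
    using rr[OF assms(3)] assms(3) by (auto simp: glue_max)
  have iff: "?g ?p < ?g (Suc r + j) \<longleftrightarrow> \<beta> q < \<beta> j" "?g (Suc r + j) < ?g ?p \<longleftrightarrow> \<beta> j < \<beta> q"
    "Suc r + j < ?p \<longleftrightarrow> j < q" "?p < Suc r + j \<longleftrightarrow> q < j" if "j \<in> {1..s}" for j
    using that assms(3) by (simp_all add: glue_right del: add_Suc)
  have "card {j \<in> {1..Suc (r + s)}. ?p < j \<and> ?g ?p < ?g j} = card {j \<in> {1..s}. q < j \<and> \<beta> q < \<beta> j}"
    unfolding card_positions_split using iff max left
    by (simp cong: conj_cong del: atLeastAtMost_iff add_Suc)
  moreover have "card {j \<in> {1..Suc (r + s)}. j < ?p \<and> ?g ?p < ?g j} = card {j \<in> {1..s}. j < q \<and> \<beta> q < \<beta> j} + Suc r"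
    unfolding card_positions_split using iff max left
    by (simp cong: conj_cong del: atLeastAtMost_iff add_Suc)
  moreover have "card {j \<in> {1..Suc (r + s)}. j < ?p \<and> ?g j < ?g ?p} = card {j \<in> {1..s}. j < q \<and> \<beta> j < \<beta> q}"
    unfolding card_positions_split using iff max left
    by (simp cong: conj_cong del: atLeastAtMost_iff add_Suc)
  moreover have "card {j \<in> {1..Suc (r + s)}. ?p < j \<and> ?g j < ?g ?p} = card {j \<in> {1..s}. q < j \<and> \<beta> j < \<beta> q}"
    unfolding card_positions_split using iff max left
    by (simp cong: conj_cong del: atLeastAtMost_iff add_Suc)
  ultimately show ?thesis
    unfolding matches_MMP_def by auto
qed

lemma mmp_glue:
  assumes "\<alpha> \<in> S132 r" "\<beta> \<in> S132 s" "1 \<le> a"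
  shows "mmp a b c d (Suc (r + s)) (glue r s \<alpha> \<beta>)
     = mmp (a - 1) b c (d - s) r \<alpha> + mmp a (b - Suc r) c d s \<beta>"
  unfolding mmp_def card_positions_split
  using matches_glue_left[OF assms] not_matches_glue_max[OF assms] matches_glue_right[OF assms(1,2)]
  by (simp cong: conj_cong del: atLeastAtMost_iff add_Suc)

theorem Qn132_Suc:
  assumes "1 \<le> a"
  shows "Qn132 a b c d (Suc n)
     = (\<Sum>r\<le>n. Qn132 (a - 1) b c (d - (n - r)) r * Qn132 a (b - Suc r) c d (n - r))"
proof -
  have "monom 1 (mmp a b c d (Suc n) (glue r (n - r) \<alpha> \<beta>))
      = monom 1 (mmp (a - 1) b c (d - (n - r)) r \<alpha>)
        * (monom 1 (mmp a (b - Suc r) c d (n - r) \<beta>) :: int poly)"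
    if "r \<le> n" "\<alpha> \<in> S132 r" "\<beta> \<in> S132 (n - r)" for r \<alpha> \<beta>
    using mmp_glue[OF that(2,3) assms, of b c d] that(1) by (simp add: mult_monom)
  then show ?thesis
    unfolding Qn132_def sum_S132_Suc sum_product
    by (intro sum.cong) auto
qed

section \<open>Permutations too short to contain a match\<close>

text \<open>The four quadrants of a position are disjoint and do not contain the position itself.\<close>

lemma matches_MMP_length:
  assumes "i \<in> {1..n}" "matches_MMP a b c d n \<sigma> i"
  shows "a + b + c + d < n"
proof -
  let ?A = "{j \<in> {1..n}. i < j \<and> \<sigma> i < \<sigma> j}" and ?B = "{j \<in> {1..n}. j < i \<and> \<sigma> i < \<sigma> j}"
    and ?C = "{j \<in> {1..n}. j < i \<and> \<sigma> j < \<sigma> i}" and ?D = "{j \<in> {1..n}. i < j \<and> \<sigma> j < \<sigma> i}"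
  have fin: "finite {j \<in> {1..n}. P j}" for P
    by simp
  have disj: "?A \<inter> ?B = {}" "(?A \<union> ?B) \<inter> ?C = {}" "(?A \<union> ?B \<union> ?C) \<inter> ?D = {}"
    by auto
  have "a + b + c + d \<le> card ?A + card ?B + card ?C + card ?D"
    using assms(2) unfolding matches_MMP_def by linarith
  also have "\<dots> = card (?A \<union> ?B \<union> ?C \<union> ?D)"
    by (simp only: card_Un_disjoint fin finite_Un disj simp_thms)
  also have "\<dots> \<le> card ({1..n} - {i})"
    by (intro card_mono) auto
  also have "\<dots> < n"
    using assms(1) by simp
  finally show ?thesis .
qed

lemma Qn132_short:
  assumes "n \<le> a + b + c + d"
  shows "Qn132 a b c d n = of_nat (catalan n)"
proof -
  have "mmp a b c d n \<sigma> = 0" for \<sigma>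
    using matches_MMP_length[of _ n a b c d \<sigma>] assms by (fastforce simp: mmp_def)
  then show ?thesis
    by (simp add: Qn132_def card_S132)
qed

section \<open>Coefficients of the generating function\<close>

lemma Q132_nth: "fps_nth (Q132 a b c d) n = Qn132 a b c d n"
  by (simp add: Q132_def Qn132_short)

lemma cat_term_mult_nth:
  "fps_nth (cat_term i * F) n = (if n < i then 0 else of_nat (catalan i) * fps_nth F (n - i))"
  by (simp add: mult.assoc fps_X_power_mult_nth flip: fps_of_nat)

lemma sum_cat_term_nth:
  "fps_nth (\<Sum>r<N. cat_term r) n = (if n < N then of_nat (catalan n) else 0)"
proof -
  have "fps_nth (\<Sum>r<N. cat_term r) n = (\<Sum>r<N. if r = n then of_nat (catalan n) else 0)"
    unfolding fps_sum_nth using cat_term_mult_nth[of _ 1 n] by (intro sum.cong) auto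
  then show ?thesis
    by simp
qed

text \<open>
  Subtracting Catalan terms of degree up to \<open>a + b + c + d\<close> truncates the series, because its
  coefficients in these degrees are Catalan numbers.
\<close>

lemma Q132_tail_nth:
  assumes "N \<le> Suc (a + b + c + d)"
  shows "fps_nth (Q132 a b c d - (\<Sum>r<N. cat_term r)) n = (if n < N then 0 else Qn132 a b c d n)"
  using assms by (simp add: Q132_nth sum_cat_term_nth Qn132_short)

theorem theorem13:
  fixes l k m :: nat
  assumes "l \<ge> 1" and "k \<ge> 1" and "m \<ge> 1"
  shows "Q132 l k 0 m =
      (\<Sum>p<k + m. cat_term p)
    + fps_X * (\<Sum>i<k - 1. cat_term i *
        (Q132 l (k - 1 - i) 0 m - (\<Sum>r<k - i + m - 1. cat_term r)))
    + fps_X * (Q132 (l - 1) k 0 0 - (\<Sum>a<k - 1. cat_term a))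
            * (Q132 l 0 0 m - (\<Sum>b<m. cat_term b))
    + fps_X * (\<Sum>j<m. cat_term j *
        (Q132 (l - 1) k 0 (m - j) - (\<Sum>s<k + m - j - 1. cat_term s)))"
    (is "_ = ?head + fps_X * ?T1 + fps_X * ?U * ?V + fps_X * ?T2")
proof (rule fps_ext)
  fix n
  show "fps_nth (Q132 l k 0 m) n
      = fps_nth (?head + fps_X * ?T1 + fps_X * ?U * ?V + fps_X * ?T2) n"
  proof (cases n)
    case 0
    with assms show ?thesis
      by (simp add: Q132_nth sum_cat_term_nth Qn132_short mult.assoc)
  next
    case (Suc N)
    \<comment> \<open>In both sums over single Catalan terms, the truncation point of the subtracted sum moves
      with the index so that each summand starts in the same degree \<open>k + m - 1\<close>.\<close>
    have T1: "fps_nth ?T1 N = (\<Sum>i<k - 1. if N < k + m - 1 then 0 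
        else of_nat (catalan i) * Qn132 l (k - 1 - i) 0 m (N - i))"
      unfolding fps_sum_nth using assms
      by (intro sum.cong refl) (subst cat_term_mult_nth, subst Q132_tail_nth, auto)
    have T2: "fps_nth ?T2 N = (\<Sum>j<m. if N < k + m - 1 then 0 
        else of_nat (catalan j) * Qn132 (l - 1) k 0 (m - j) (N - j))"
      unfolding fps_sum_nth using assms
      by (intro sum.cong refl) (subst cat_term_mult_nth, subst Q132_tail_nth, auto)
    have UV: "fps_nth (?U * ?V) N = (\<Sum>i\<le>N. (if i < k - 1 then 0 else Qn132 (l - 1) k 0 0 i)
        * (if N - i < m then 0 else Qn132 l 0 0 m (N - i)))"
      unfolding fps_mult_nth atMost_atLeast0 using assms
      by (intro sum.cong refl) (subst Q132_tail_nth, simp, subst Q132_tail_nth, auto)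
    have coeff: "fps_nth (?head + fps_X * ?T1 + fps_X * ?U * ?V + fps_X * ?T2) n
        = (if n < k + m then of_nat (catalan n) else 0)
          + fps_nth ?T1 N + fps_nth (?U * ?V) N + fps_nth ?T2 N"
      unfolding Suc fps_add_nth sum_cat_term_nth mult.assoc[of fps_X] fps_X_mult_nth by simp
    show ?thesis
    proof (cases "n < k + m")
      case True
      \<comment> \<open>A nonzero product would need \<open>i \<ge> k - 1\<close> and \<open>N - i \<ge> m\<close>, hence \<open>N \<ge> k + m - 1\<close>.\<close>
      then have "fps_nth (?U * ?V) N = 0"
        unfolding UV Suc by (intro sum.neutral) auto
      moreover have "N < k + m - 1"
        using True Suc by simp
      ultimately show ?thesis
        unfolding coeff T1 T2 using True by (simp add: Q132_nth Qn132_short)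
    next
      case False
      then have large: "k + m - 1 \<le> N"
        by (simp add: Suc)
      let ?t = "\<lambda>r. Qn132 (l - 1) k 0 (m - (N - r)) r * Qn132 l (k - Suc r) 0 m (N - r)"
      have "fps_nth (Q132 l k 0 m) n = (\<Sum>r\<le>N. ?t r)"
        unfolding Q132_nth Suc by (rule Qn132_Suc[OF assms(1)])
      \<comment> \<open>The ranges \<open>r < k - 1\<close> and \<open>N - r < m\<close> are disjoint because \<open>N \<ge> k + m - 1\<close>.\<close>
      also have "\<dots> = (\<Sum>r\<le>N. (if r < k - 1 then ?t r else 0)
            + (if k - 1 \<le> r \<and> m \<le> N - r then ?t r else 0) + (if N - r < m then ?t r else 0))"
        using large by (intro sum.cong) auto
      also have "\<dots> = (\<Sum>r\<le>N. if r < k - 1 then ?t r else 0)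
            + (\<Sum>r\<le>N. if k - 1 \<le> r \<and> m \<le> N - r then ?t r else 0)
            + (\<Sum>r\<le>N. if N - r < m then ?t r else 0)"
        by (simp add: sum.distrib)
      also have "(\<Sum>r\<le>N. if r < k - 1 then ?t r else 0) = fps_nth ?T1 N"
      proof -
        have "{r \<in> {..N}. r < k - 1} = {..<k - 1}"
          using large by auto
        then show ?thesis
          unfolding T1 using large
          by (simp add: sum.If_cases Int_def) (auto intro!: sum.cong simp: Qn132_short)
      qed
      also have "(\<Sum>r\<le>N. if k - 1 \<le> r \<and> m \<le> N - r then ?t r else 0) = fps_nth (?U * ?V) N"
        unfolding UV by (intro sum.cong) auto
      also have "(\<Sum>r\<le>N. if N - r < m then ?t r else 0) = fps_nth ?T2 N"
      proof -
        have "(\<Sum>r\<le>N. if N - r < m then ?t r else 0) = (\<Sum>j\<le>N. if j < m then ?t (N - j) else 0)"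
          unfolding atMost_atLeast0 by (subst sum.atLeastAtMost_rev) (auto intro!: sum.cong)
        also have "\<dots> = (\<Sum>j<m. ?t (N - j))"
          using large assms by (intro sum.mono_neutral_cong_right) auto
        also have "\<dots> = fps_nth ?T2 N"
          unfolding T2
        proof (rule sum.cong[OF refl])
          fix j assume "j \<in> {..<m}"
          then have "j < m" and j: "N - (N - j) = j" "k - Suc (N - j) = 0"
            using large assms by auto
          then show "?t (N - j) = (if N < k + m - 1 then 0
              else of_nat (catalan j) * Qn132 (l - 1) k 0 (m - j) (N - j))"
            unfolding j using large by (simp add: Qn132_short)
        qed
        finally show ?thesis .
      qed
      finally show ?thesis
        unfolding coeff using False by (simp only: if_False add_0_left)
    qed
  qed
qed

end
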